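(* Let $\mathcal{H}$ be a real Hilbert space, $J\in\mathcal{C}$, and let $(u,p)$ be the solution of the gradient flow of $J$ with initial datum $f$. If the gradient flow generates eigenvectors, i.e. $p(t)\in\partial J(p(t))$ for all $t>0$, then for all $0<r\le s\le t$ it holds $$\langle p(t),p(s)-p(r)\rangle=0.$$
   Context: The class $\mathcal{C}$ consists of all maps $J:\mathcal{H}\to\mathbb{R}\cup\{+\infty\}$ that are convex, lower semicontinuous with respect to the strong topology of $\mathcal{H}$, and absolutely one-homogeneous, i.e. $J(cu)=|c|J(u)$ for all $u\in\mathcal{H}$, $c\in\mathbb{R}\setminus\{0\}$, and $J(0)=0$. The subdifferential is $\partial J(u)=\{p\in\mathcal{H}:\langle p,v\rangle\le J(v)\ \forall v\in\mathcal{H},\ \langle p,u\rangle=J(u)\}$, and $\mathrm{dom}(\partial J)=\{u:\partial J(u)\ne\emptyset\}$. Gradient flow: for $f\in\overline{\mathrm{dom}(\partial J)}$, the solution $(u,p)$ of $\partial_tu(t)=-p(t)$, $p(t)\in\partial J(u(t))$, $u(0)=f$ is the unique continuous $u:[0,\infty)\to\mathcal{H}$ with $u(0)=f$ given by Brezis' theory (Lipschitz on $[\delta,\infty)$ for every $\delta>0$, $u(t)\in\mathrm{dom}(\partial J)$ for all $t>0$, right-differentiable at every $t>0$), together with $p(t):=-\partial_t^+u(t)$, which is the element of minimal norm in $\partial J(u(t))$ for every $t>0$. *)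

theory Defs
  imports "HOL-Analysis.Analysis"
begin

text \<open>
  A real Hilbert space is a type of sort \<open>{real_inner, complete_space}\<close>. Functionals with values
  in the reals extended by \<open>+\<infinity>\<close> are \<open>ereal\<close>-valued functions that never take the value \<open>-\<infinity>\<close>.
\<close>

definition ereal_convex :: "('a::real_vector \<Rightarrow> ereal) \<Rightarrow> bool" where
  "ereal_convex J \<longleftrightarrow>
    (\<forall>u v. \<forall>a\<ge>0. \<forall>b\<ge>0. a + b = 1 \<longrightarrow>
      J (a *\<^sub>R u + b *\<^sub>R v) \<le> ereal a * J u + ereal b * J v)"

definition lower_semicontinuous :: "('a::topological_space \<Rightarrow> ereal) \<Rightarrow> bool" where
  "lower_semicontinuous J \<longleftrightarrow> (\<forall>u. J u \<le> Liminf (at u) J)"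

definition absolutely_one_homogeneous :: "('a::real_vector \<Rightarrow> ereal) \<Rightarrow> bool" where
  "absolutely_one_homogeneous J \<longleftrightarrow>
    (\<forall>u. \<forall>c. c \<noteq> 0 \<longrightarrow> J (c *\<^sub>R u) = ereal \<bar>c\<bar> * J u) \<and> J 0 = 0"

definition class_C :: "('a::{real_inner, complete_space} \<Rightarrow> ereal) set" where
  "class_C = {J. (\<forall>u. J u \<noteq> -\<infinity>) \<and> ereal_convex J \<and> lower_semicontinuous J \<and>
                 absolutely_one_homogeneous J}"

definition subdifferential ::
    "('a::{real_inner, complete_space} \<Rightarrow> ereal) \<Rightarrow> 'a \<Rightarrow> 'a set" where
  "subdifferential J u = {p. (\<forall>v. ereal (p \<bullet> v) \<le> J v) \<and> ereal (p \<bullet> u) = J u}"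

definition dom_subdifferential ::
    "('a::{real_inner, complete_space} \<Rightarrow> ereal) \<Rightarrow> 'a set" where
  "dom_subdifferential J = {u. subdifferential J u \<noteq> {}}"

text \<open>
  The pair \<open>(u, p)\<close> solves the gradient flow of \<open>J\<close> with initial datum \<open>f\<close> in the sense of Brezis.
  Only \<open>u\<close> on \<open>[0, \<infinity>)\<close> and \<open>p\<close> on \<open>(0, \<infinity>)\<close> are meaningful; values outside are unconstrained.
  The vector derivative along \<open>at_right t\<close> is the right derivative, so \<open>p\<close> is minus the right
  derivative of \<open>u\<close>.
\<close>

definition gradient_flow_solution ::
    "('a::{real_inner, complete_space} \<Rightarrow> ereal) \<Rightarrow> 'a \<Rightarrow> (real \<Rightarrow> 'a) \<Rightarrow> (real \<Rightarrow> 'a) \<Rightarrow> bool" where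
  "gradient_flow_solution J f u p \<longleftrightarrow>
    continuous_on {0..} u \<and> u 0 = f \<and>
    (\<forall>\<delta>>0. \<exists>L. L-lipschitz_on {\<delta>..} u) \<and>
    (\<forall>t>0. u t \<in> dom_subdifferential J \<and>
           (u has_vector_derivative - p t) (at_right t) \<and>
           p t \<in> subdifferential J (u t) \<and>
           (\<forall>q\<in>subdifferential J (u t). norm (p t) \<le> norm q))"

end

theory Submission
  imports Defs
begin

text \<open>
  Let \<open>K\<close> be the set of all \<open>q\<close> with \<open>q \<bullet> v \<le> J v\<close> for every \<open>v\<close>; it contains every \<open>p \<tau>\<close>. Since
  \<open>p t\<close> is an eigenvector, \<open>q \<bullet> p t \<le> J (p t) = p t \<bullet> p t\<close> for \<open>q \<in> K\<close>, so in particular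
  \<open>p t \<bullet> p s \<le> p t \<bullet> p t\<close>. The theorem follows once the reverse inequality is known for
  \<open>0 < s \<le> t\<close>, because then \<open>p t \<bullet> p s\<close> does not depend on \<open>s \<in> (0, t]\<close>.

  The reverse inequality is the variational characterisation of \<open>p t\<close> as the element of minimal norm
  of the convex set \<open>subdifferential J (u t)\<close>, provided that \<open>p s\<close> belongs to this set: subgradients
  of earlier times must stay subgradients. To see this, compare \<open>p s \<bullet> u \<tau>\<close> with \<open>J (u \<tau>)\<close> for
  \<open>\<tau> \<ge> s\<close>. They agree at \<open>\<tau> = s\<close>, and \<open>p s \<bullet> u \<tau> \<le> J (u \<tau>)\<close> always. The former decreases at rate
  \<open>p s \<bullet> p \<tau> \<le> p \<tau> \<bullet> p \<tau>\<close> by the eigenvector property, while the energy \<open>J (u \<tau>)\<close> is dissipated at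
  rate \<open>p \<tau> \<bullet> p \<tau>\<close>. So the difference cannot decrease and the equality persists
  (\<open>subgradient_persists\<close>).

  The dissipation rate is the delicate point: the usual derivation rests on right continuity of \<open>p\<close>,
  which is proved by weak compactness. The argument below avoids this with a weaker form of the rate:
  if the average rate of energy decrease on \<open>[\<tau>, y]\<close> is at most \<open>k\<close> for all \<open>y\<close> close to \<open>\<tau>\<close>, then
  \<open>p \<tau> \<bullet> p \<tau> \<le> k\<close> (\<open>energy_dissipation_rate\<close>). This gives only that the upper right Dini derivative
  of the difference is nonnegative, but for a continuous function that is enough for monotonicity
  (\<open>dini_mono\<close>).
\<close>

text \<open>
  The hypothesis \<open>step\<close> asks for one point \<open>y\<close>, at any distance to the right of \<open>x\<close>; it follows from
  a nonnegative upper right Dini derivative. If the slope from \<open>a\<close> is at least \<open>- e\<close> at \<open>x\<close>, then \<open>y\<close>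
  inherits this bound, and continuity provides a last such point.
\<close>
lemma dini_mono:
  fixes f :: "real \<Rightarrow> real"
  assumes "a \<le> b" and cont: "continuous_on {a..b} f"
    and step: "\<And>x e. a \<le> x \<Longrightarrow> x < b \<Longrightarrow> 0 < e \<Longrightarrow> \<exists>y>x. y \<le> b \<and> f x - e * (y - x) \<le> f y"
  shows "f a \<le> f b"
proof -
  have main: "f a \<le> f b + e * (b - a)" if e: "0 < e" for e
  proof -
    \<comment> \<open>The last point whose slope from \<open>a\<close> is at least \<open>- e\<close> must be \<open>b\<close>.\<close>
    define S where "S = {x\<in>{a..b}. f a \<le> f x + e * (x - a)}"
    have "closed S"
      unfolding S_def by (intro continuous_on_closed_Collect_le continuous_intros cont closed_atLeastAtMost)
    moreover have "bounded S"
      by (rule bounded_subset[OF bounded_closed_interval[of a b]]) (auto simp: S_def)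
    ultimately have "compact S" by (simp add: compact_eq_bounded_closed)
    moreover have "a \<in> S" using \<open>a \<le> b\<close> by (auto simp: S_def)
    ultimately obtain x where x: "x \<in> S" and max: "\<And>y. y \<in> S \<Longrightarrow> y \<le> x"
      using compact_attains_sup[of S] by blast
    have "x = b"
    proof (rule ccontr)
      assume "x \<noteq> b"
      then obtain y where "y > x" "y \<le> b" "f x - e * (y - x) \<le> f y"
        using step[of x e] x e by (auto simp: S_def)
      then have "y \<in> S" using x by (auto simp: S_def algebra_simps)
      then show False using max \<open>y > x\<close> by force
    qed
    then show ?thesis using x by (simp add: S_def)
  qed
  show ?thesis
  proof (cases "a = b")
    case False
    then have "f a \<le> f b + e" if "0 < e" for e
      using main[of "e / (b - a)"] that \<open>a \<le> b\<close> by simp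
    then show ?thesis by (rule field_le_epsilon)
  qed simp
qed

lemma right_derivative_nonneg_mono:
  fixes f :: "real \<Rightarrow> real"
  assumes "a \<le> b" and "continuous_on {a..b} f"
    and deriv: "\<And>x. a \<le> x \<Longrightarrow> x < b \<Longrightarrow> (f has_vector_derivative f' x) (at_right x)"
    and nonneg: "\<And>x. a \<le> x \<Longrightarrow> x < b \<Longrightarrow> 0 \<le> f' x"
  shows "f a \<le> f b"
proof (rule dini_mono[OF assms(1,2)])
  fix x e :: real
  assume x: "a \<le> x" "x < b" and e: "0 < e"
  have "((\<lambda>y. (f y - f x) / (y - x)) \<longlongrightarrow> f' x) (at_right x)"
    using deriv[OF x] by (simp add: has_real_derivative_iff_has_vector_derivative[symmetric]
        has_field_derivative_iff)
  then have "\<forall>\<^sub>F y in at_right x. - e < (f y - f x) / (y - x)"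
    using nonneg[OF x] e by (intro order_tendstoD(1)) auto
  moreover have "\<forall>\<^sub>F y in at_right x. y \<in> {x<..<b}"
    using x by (intro eventually_at_right_real)
  ultimately have "\<forall>\<^sub>F y in at_right x. y \<in> {x<..<b} \<and> - e < (f y - f x) / (y - x)"
    by eventually_elim simp
  then obtain y where y: "x < y" "y < b" "- e < (f y - f x) / (y - x)"
    using eventually_happens'[OF trivial_limit_at_right_real] by fastforce
  then have "- e * (y - x) < f y - f x" by (simp add: pos_less_divide_eq)
  then show "\<exists>y>x. y \<le> b \<and> f x - e * (y - x) \<le> f y"
    using y by (intro exI[of _ y]) auto
qed

lemma right_quotient_tendsto:
  fixes u :: "real \<Rightarrow> 'a::real_normed_vector"
  assumes "(u has_vector_derivative - v) (at_right x)"
  shows "((\<lambda>y. (u x - u y) /\<^sub>R (y - x)) \<longlongrightarrow> v) (at_right x)"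
proof -
  let ?r = "\<lambda>y. (1 / norm (y - x)) *\<^sub>R (u y - (u x + (y - x) *\<^sub>R - v))"
  have "(?r \<longlongrightarrow> 0) (at_right x)"
    using assms by (simp add: has_vector_derivative_def has_derivative_within)
  then have "((\<lambda>y. v - ?r y) \<longlongrightarrow> v) (at_right x)"
    using tendsto_diff[OF tendsto_const] by fastforce
  moreover have "\<forall>\<^sub>F y in at_right x. v - ?r y = (u x - u y) /\<^sub>R (y - x)"
    using eventually_at_right_less[of x]
  proof eventually_elim
    case (elim y)
    have "?r y = (1 / (y - x)) *\<^sub>R ((u y - u x) + (y - x) *\<^sub>R v)"
      using elim by (simp add: algebra_simps)
    also have "\<dots> = (u y - u x) /\<^sub>R (y - x) + v"
      using elim by (subst scaleR_add_right) (simp add: divide_inverse)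
    finally show ?case by (simp flip: scaleR_minus_right)
  qed
  ultimately show ?thesis by (rule Lim_transform_eventually)
qed

text \<open>
  Here \<open>G\<close> is the energy along \<open>u\<close>, and \<open>subgrad\<close> is the subgradient inequality at the later time.
  Its left-hand side is the right derivative of \<open>\<lambda>y. (norm (u x - u y))\<^sup>2 / 2\<close>. So a decrease of \<open>G\<close> of at
  most \<open>k * (y - x)\<close> integrates to \<open>(norm (u x - u y))\<^sup>2 \<le> k * (y - x)\<^sup>2\<close>, and
  the quotient of both sides by \<open>(y - x)\<^sup>2\<close> tends to the claim.
\<close>
lemma energy_dissipation_rate:
  fixes u p :: "real \<Rightarrow> 'a::real_inner" and G :: "real \<Rightarrow> real"
  assumes "x < b" and cont: "continuous_on {x..b} u"
    and deriv: "\<And>y. x \<le> y \<Longrightarrow> y < b \<Longrightarrow> (u has_vector_derivative - p y) (at_right y)"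
    and subgrad: "\<And>y. x \<le> y \<Longrightarrow> y < b \<Longrightarrow> p y \<bullet> (u x - u y) \<le> G x - G y"
    and decrease: "\<And>y. x \<le> y \<Longrightarrow> y < b \<Longrightarrow> G x - G y \<le> k * (y - x)"
  shows "p x \<bullet> p x \<le> k"
proof -
  have bound: "(u x - u y) \<bullet> (u x - u y) \<le> k * (y - x)\<^sup>2" if y: "x < y" "y < b" for y
  proof -
    define f where "f z = k * (z - x)\<^sup>2 - (u x - u z) \<bullet> (u x - u z)" for z
    have "f x \<le> f y"
    proof (rule right_derivative_nonneg_mono[where f = f])
      show "continuous_on {x..y} f"
        unfolding f_def using y
        by (intro continuous_intros continuous_on_subset[OF cont]) auto
      fix z assume z: "x \<le> z" "z < y"
      have du: "(u has_vector_derivative - p z) (at_right z)" using deriv z y by simp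
      have sq: "((\<lambda>z. (z - x)\<^sup>2) has_vector_derivative 2 * (z - x)) (at_right z)"
        unfolding has_real_derivative_iff_has_vector_derivative[symmetric]
        by (auto intro!: derivative_eq_intros)
      have d: "((\<lambda>z. u x - u z) has_vector_derivative p z) (at_right z)"
        using has_vector_derivative_diff[OF has_vector_derivative_const du] by simp
      have ip: "((\<lambda>z. (u x - u z) \<bullet> (u x - u z)) has_vector_derivative
            2 * (p z \<bullet> (u x - u z))) (at_right z)"
        using bounded_bilinear.has_vector_derivative[OF bounded_bilinear_inner d d]
        by (simp add: inner_commute)
      show "(f has_vector_derivative k * (2 * (z - x)) - 2 * (p z \<bullet> (u x - u z))) (at_right z)"
        unfolding f_def
        by (intro has_vector_derivative_diff ip has_vector_derivative_mult_right sq)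
      show "0 \<le> k * (2 * (z - x)) - 2 * (p z \<bullet> (u x - u z))"
      proof -
        have "p z \<bullet> (u x - u z) \<le> k * (z - x)"
          using order_trans[OF subgrad[of z] decrease[of z]] z y by simp
        moreover have "k * (2 * (z - x)) = 2 * (k * (z - x))" by (rule mult.left_commute)
        ultimately show ?thesis by linarith
      qed
    qed (use y in simp)
    then show ?thesis by (simp add: f_def)
  qed
  let ?q = "\<lambda>y. (u x - u y) /\<^sub>R (y - x)"
  have "((\<lambda>y. ?q y \<bullet> ?q y) \<longlongrightarrow> p x \<bullet> p x) (at_right x)"
    using right_quotient_tendsto[OF deriv[of x]] \<open>x < b\<close> by (intro tendsto_inner) auto
  moreover have "\<forall>\<^sub>F y in at_right x. ?q y \<bullet> ?q y \<le> k"
    using eventually_at_right_real[OF \<open>x < b\<close>]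
  proof eventually_elim
    case (elim y)
    then have "?q y \<bullet> ?q y = (u x - u y) \<bullet> (u x - u y) / (y - x)\<^sup>2"
      by (simp add: power2_eq_square divide_simps)
    also have "\<dots> \<le> k"
      using bound[of y] elim by (simp add: pos_divide_le_eq)
    finally show ?case .
  qed
  ultimately show ?thesis
    by (rule tendsto_upperbound) simp
qed

lemma convex_subdifferential: "convex (subdifferential J x)"
proof (rule convexI)
  fix p q :: 'a and a b :: real
  assume p: "p \<in> subdifferential J x" and q: "q \<in> subdifferential J x"
    and ab: "0 \<le> a" "0 \<le> b" "a + b = 1"
  have "ereal ((a *\<^sub>R p + b *\<^sub>R q) \<bullet> v) \<le> J v" for v
  proof -
    have "(a *\<^sub>R p + b *\<^sub>R q) \<bullet> v \<le> max (p \<bullet> v) (q \<bullet> v)"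
      using ab convex_bound_le[of "p \<bullet> v" "max (p \<bullet> v) (q \<bullet> v)" "q \<bullet> v" a b]
      by (simp add: inner_add_left)
    moreover have "ereal (max (p \<bullet> v) (q \<bullet> v)) \<le> J v"
      using p q by (simp add: subdifferential_def max_def)
    ultimately show ?thesis
      using order_trans ereal_less_eq(3) by blast
  qed
  moreover have "ereal ((a *\<^sub>R p + b *\<^sub>R q) \<bullet> x) = J x"
  proof -
    have "q \<bullet> x = p \<bullet> x" using p q by (auto simp: subdifferential_def simp flip: ereal.inject)
    then have "(a *\<^sub>R p + b *\<^sub>R q) \<bullet> x = (a + b) * (p \<bullet> x)"
      by (simp add: inner_add_left distrib_right)
    then show ?thesis using p ab by (simp add: subdifferential_def)
  qed
  ultimately show "a *\<^sub>R p + b *\<^sub>R q \<in> subdifferential J x"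
    by (simp add: subdifferential_def)
qed

lemma min_norm_inner_le:
  fixes x y :: "'a::real_inner"
  assumes "convex S" "x \<in> S" "y \<in> S" and min: "\<And>z. z \<in> S \<Longrightarrow> norm x \<le> norm z"
  shows "x \<bullet> x \<le> x \<bullet> y"
proof (rule ccontr)
  assume "\<not> ?thesis"
  then have "0 < (0 - x) \<bullet> (y - x)" by (simp add: inner_diff_right)
  from closer_point_lemma[OF this] obtain c where
    c: "0 < c" "c \<le> 1" "norm (x + c *\<^sub>R (y - x)) < norm x"
    by (auto simp: dist_norm)
  have "x + c *\<^sub>R (y - x) = (1 - c) *\<^sub>R x + c *\<^sub>R y" by (simp add: algebra_simps)
  also have "\<dots> \<in> S" using assms c by (intro convexD) auto
  finally show False using min c by force
qed

lemma gradient_flow_velocity_bounded: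
  assumes "gradient_flow_solution J f u p" and "L-lipschitz_on {d..} u"
    and "0 < d" "d \<le> x"
  shows "norm (p x) \<le> L"
proof -
  have "((\<lambda>y. norm ((u x - u y) /\<^sub>R (y - x))) \<longlongrightarrow> norm (p x)) (at_right x)"
    using assms by (intro tendsto_norm right_quotient_tendsto) (auto simp: gradient_flow_solution_def)
  moreover have "\<forall>\<^sub>F y in at_right x. norm ((u x - u y) /\<^sub>R (y - x)) \<le> L"
    using eventually_at_right_real[of x "x + 1", simplified]
  proof eventually_elim
    case (elim y)
    have "norm (u x - u y) \<le> L * \<bar>x - y\<bar>"
      using lipschitz_onD[OF assms(2), of x y] elim assms(4) by (simp add: dist_norm)
    then show ?case using elim by (simp add: divide_simps)
  qed
  ultimately show ?thesis by (rule tendsto_upperbound) simp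
qed

text \<open>
  The subgradient inequalities at both times bound energy differences by velocity times distance.
\<close>
lemma gradient_flow_energy_continuous:
  assumes flow: "gradient_flow_solution J f u p" and "0 < d"
    and subgrad: "\<And>x y. 0 < x \<Longrightarrow> 0 < y \<Longrightarrow> p x \<bullet> u y \<le> p y \<bullet> u y"
  shows "continuous_on {d..} (\<lambda>x. p x \<bullet> u x)"
proof -
  obtain L where L: "L-lipschitz_on {d..} u"
    using flow \<open>0 < d\<close> by (auto simp: gradient_flow_solution_def)
  have one: "p x \<bullet> u x - p y \<bullet> u y \<le> L * (L * dist x y)" if "d \<le> x" "d \<le> y" for x y
  proof -
    have "p x \<bullet> u x - p y \<bullet> u y \<le> p x \<bullet> (u x - u y)"
      using subgrad[of x y] that \<open>0 < d\<close> by (simp add: inner_diff_right)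
    also have "\<dots> \<le> norm (p x) * norm (u x - u y)" by (rule norm_cauchy_schwarz)
    also have "\<dots> \<le> L * (L * dist x y)"
      using gradient_flow_velocity_bounded[OF flow L] lipschitz_onD[OF L, of x y]
        lipschitz_on_nonneg[OF L] that \<open>0 < d\<close>
      by (intro mult_mono) (auto simp: dist_norm)
    finally show ?thesis .
  qed
  have "(L * L)-lipschitz_on {d..} (\<lambda>x. p x \<bullet> u x)"
  proof (rule lipschitz_onI)
    fix x y :: real assume "x \<in> {d..}" "y \<in> {d..}"
    then show "dist (p x \<bullet> u x) (p y \<bullet> u y) \<le> L * L * dist x y"
      using one[of x y] one[of y x] by (simp add: dist_real_def abs_minus_commute)
  qed simp
  then show ?thesis by (rule lipschitz_on_continuous_on)
qed

text \<open>
  The difference \<open>W x\<close> of \<open>p s \<bullet> u x\<close> and the energy at time \<open>x\<close> is at most \<open>0\<close> and vanishes at \<open>s\<close>. If it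
  fell at some rate \<open>e\<close> right after \<open>x\<close>, the energy would decay more slowly than at rate \<open>p x \<bullet> p x\<close>,
  since \<open>p s \<bullet> u\<close> decays at most that fast by the eigenvector property; this is excluded by
  \<open>energy_dissipation_rate\<close>. So \<open>W t = 0\<close>, which is the equality in the definition of a subgradient.
\<close>
lemma subgradient_persists:
  assumes flow: "gradient_flow_solution J f u p"
    and eigen: "\<And>x. 0 < x \<Longrightarrow> p x \<in> subdifferential J (p x)"
    and "0 < s" "s \<le> t"
  shows "p s \<in> subdifferential J (u t)"
proof -
  have le: "ereal (p x \<bullet> v) \<le> J v" and energy: "J (u x) = ereal (p x \<bullet> u x)"
    and eigenvalue: "J (p x) = ereal (p x \<bullet> p x)" if "0 < x" for x v
    using flow eigen[OF that] that by (auto simp: gradient_flow_solution_def subdifferential_def)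
  have subgrad: "p x \<bullet> u y \<le> p y \<bullet> u y" if "0 < x" "0 < y" for x y
    using le[of x "u y"] energy[of y] that by simp
  have proj: "p x \<bullet> p y \<le> p y \<bullet> p y" if "0 < x" "0 < y" for x y
    using le[of x "p y"] eigenvalue[of y] that by simp
  have deriv: "(u has_vector_derivative - p x) (at_right x)" if "0 < x" for x
    using flow that by (simp add: gradient_flow_solution_def)
  have cont: "continuous_on {s..} u"
    using flow \<open>0 < s\<close> unfolding gradient_flow_solution_def
    by (auto intro: continuous_on_subset)
  define W where "W x = p s \<bullet> u x - p x \<bullet> u x" for x
  have "W s \<le> W t"
  proof (rule dini_mono[where f = W])
    show "continuous_on {s..t} W"
      unfolding W_def
      by (intro continuous_intros continuous_on_subset[OF cont]
          continuous_on_subset[OF gradient_flow_energy_continuous[OF flow \<open>0 < s\<close> subgrad]]) auto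
    fix x e :: real
    assume x: "s \<le> x" "x < t" and e: "0 < e"
    show "\<exists>y>x. y \<le> t \<and> W x - e * (y - x) \<le> W y"
    proof (rule ccontr)
      assume "\<not> ?thesis"
      then have drop: "W y < W x - e * (y - x)" if "x < y" "y \<le> t" for y
        using that by force
      \<comment> \<open>Then the energy would decrease at a rate of at most \<open>p x \<bullet> p x - e / 2\<close> near \<open>x\<close>.\<close>
      have "((\<lambda>y. p s \<bullet> ((u x - u y) /\<^sub>R (y - x))) \<longlongrightarrow> p s \<bullet> p x) (at_right x)"
        using x \<open>0 < s\<close> by (intro tendsto_intros right_quotient_tendsto deriv) auto
      moreover have "p s \<bullet> p x < p x \<bullet> p x + e / 2"
        using proj[of s x] x e \<open>0 < s\<close> by simp
      ultimately have "\<forall>\<^sub>F y in at_right x. p s \<bullet> ((u x - u y) /\<^sub>R (y - x)) < p x \<bullet> p x + e / 2"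
        by (rule order_tendstoD(2))
      then obtain b where "x < b"
        and b: "\<And>y. x < y \<Longrightarrow> y < b \<Longrightarrow> p s \<bullet> ((u x - u y) /\<^sub>R (y - x)) < p x \<bullet> p x + e / 2"
        unfolding eventually_at_right_field by blast
      have decrease: "p x \<bullet> u x - p y \<bullet> u y \<le> (p x \<bullet> p x - e / 2) * (y - x)"
        if y: "x \<le> y" "y < min b t" for y
      proof (cases "x = y")
        case False
        then have "p s \<bullet> ((u x - u y) /\<^sub>R (y - x)) < p x \<bullet> p x + e / 2"
          using b[of y] y by simp
        then have "p s \<bullet> (u x - u y) / (y - x) < p x \<bullet> p x + e / 2"
          by (simp only: inner_scaleR_right divide_inverse_commute)
        then have "p s \<bullet> (u x - u y) < (p x \<bullet> p x + e / 2) * (y - x)"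
          using False y by (simp add: pos_divide_less_eq)
        moreover have "p x \<bullet> u x - p y \<bullet> u y < p s \<bullet> (u x - u y) - e * (y - x)"
          using drop[of y] False y by (simp add: W_def inner_diff_right)
        moreover have "(p x \<bullet> p x + e / 2) * (y - x) - e * (y - x) = (p x \<bullet> p x - e / 2) * (y - x)"
          by (simp add: field_simps)
        ultimately show ?thesis by linarith
      qed simp
      have "p x \<bullet> p x \<le> p x \<bullet> p x - e / 2"
      proof (rule energy_dissipation_rate)
        show "x < min b t" using \<open>x < b\<close> x by simp
        show "continuous_on {x..min b t} u"
          using x by (intro continuous_on_subset[OF cont]) auto
        fix y assume y: "x \<le> y" "y < min b t"
        show "(u has_vector_derivative - p y) (at_right y)"
          using deriv y x \<open>0 < s\<close> by simp
        show "p y \<bullet> (u x - u y) \<le> p x \<bullet> u x - p y \<bullet> u y"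
          using subgrad[of y x] y x \<open>0 < s\<close> by (simp add: inner_diff_right)
        show "p x \<bullet> u x - p y \<bullet> u y \<le> (p x \<bullet> p x - e / 2) * (y - x)"
          by (rule decrease[OF y])
      qed
      then show False using e by simp
    qed
  qed (fact \<open>s \<le> t\<close>)
  then have "p s \<bullet> u t = p t \<bullet> u t"
    using subgrad[of s t] \<open>0 < s\<close> \<open>s \<le> t\<close> by (simp add: W_def)
  then show ?thesis
    using le[of s] energy[of t] \<open>0 < s\<close> \<open>s \<le> t\<close> by (simp add: subdifferential_def)
qed

theorem theorem4p7:
  fixes J :: "'a::{real_inner, complete_space} \<Rightarrow> ereal"
    and f :: 'a
    and u p :: "real \<Rightarrow> 'a"
    and r s t :: real
  assumes "J \<in> class_C"
    and "f \<in> closure (dom_subdifferential J)"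
    and "gradient_flow_solution J f u p"
    and "\<forall>\<tau>>0. p \<tau> \<in> subdifferential J (p \<tau>)"
    and "0 < r" and "r \<le> s" and "s \<le> t"
  shows "p t \<bullet> (p s - p r) = 0"
proof -
  have "p t \<bullet> p x = p t \<bullet> p t" if x: "0 < x" "x \<le> t" for x
  proof (rule antisym)
    have "ereal (p x \<bullet> p t) \<le> J (p t)" "J (p t) = ereal (p t \<bullet> p t)"
      using assms(4) x by (auto simp: subdifferential_def)
    then show "p t \<bullet> p x \<le> p t \<bullet> p t" by (simp add: inner_commute)
    show "p t \<bullet> p t \<le> p t \<bullet> p x"
    proof (rule min_norm_inner_le[OF convex_subdifferential])
      show "p x \<in> subdifferential J (u t)"
        using subgradient_persists[OF assms(3)] assms(4) x by blast
    qed (use assms(3) x in \<open>auto simp: gradient_flow_solution_def\<close>)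
  qed
  from this[of s] this[of r] show ?thesis
    using assms(5-7) by (simp add: inner_diff_right)
qed

end
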